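(* Let $p,q\ge 1$, let $C=(C^1,\dots,C^p)\in\mathfrak{so}(q)^p$ be a tuple of linearly independent skew-symmetric matrices, and let $N_C$ be the associated simply connected 2-step nilpotent Lie group with left-invariant metric. Then the metric on $N_C$ is a left-invariant Ricci Yang-Mills soliton of symmetric Lie type if and only if $C$ is a distinguished point of the action of $GL_q\mathbb R$ on $\mathfrak{so}(q)^p$, i.e. if and only if there is $r\in\mathbb R$ with $m_1(C)\cdot C=rC$.
   Context: **The group $N_C$.** Given a tuple $C=(C^1,\dots,C^p)$ of linearly independent elements of $\mathfrak{so}(q)$ (real skew-symmetric $q\times q$ matrices), $\mathfrak N_C$ is the Lie algebra $\mathbb R^q\oplus\mathbb R^p$ with standard basis $e_1,\dots,e_{q+p}$ (declared orthonormal) and bracket $[e_i,e_j]=\sum_k C^k_{ij}e_{q+k}$ for $1\le i,j\le q$, all other brackets of basis vectors being zero. $N_C$ is the simply connected Lie group with Lie algebra $\mathfrak N_C$ and the corresponding left-invariant metric. **Bundle data.** Let $N=N_C$, $\mathfrak N$ its Lie algebra, $Z=[N,N]$ (a central subgroup), $\mathfrak Z=\mathrm{Lie}(Z)$, $\mathcal H=\mathfrak Z^\perp$. Then $\pi:N\to M=N/Z$ is a principal bundle with abelian structure group $G\simeq Z\simeq\mathbb R^p$ acting by right multiplication, with Lie algebra $\mathfrak g\simeq\mathfrak Z$ carrying the restricted inner product $k$. The connection $\omega$ is the left-invariant $\mathfrak g$-valued 1-form which vanishes on $\mathcal H$ and is the identification $\mathfrak Z\simeq\mathfrak g$ on $\mathfrak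 Z$. The curvature $\Omega=d\omega$ descends to a $\mathfrak g$-valued 2-form $\tilde\Omega$ on the abelian Lie group $M$. Let $g$ be the induced left-invariant metric on $M$, and set $\tilde\Omega^2_{ij}=\sum g^{kl}k^{\alpha\beta}\tilde\Omega_{\alpha ki}\tilde\Omega_{\beta lj}$ (Greek indices: Lie algebra indices in $\mathfrak g$; Roman indices: indices on $M$). **Soliton of (symmetric) Lie type.** The left-invariant metric is a Ricci Yang-Mills soliton of Lie type if there are $\lambda\in\mathbb R$ and a derivation $D$ of the abelian Lie algebra $\mathfrak N/\mathfrak Z$ (i.e. any linear map $D:\mathfrak N/\mathfrak Z\to\mathfrak N/\mathfrak Z$) such that for all left-invariant vector fields $v,w$ on $M$ $$\tilde\Omega^2(v,w)=g((D+D^t)v,w)+\lambda g(v,w),\qquad 0=\tilde\Omega(Dv,w)+\tilde\Omega(v,Dw),$$ where $D^t$ is the adjoint with respect to $g$. It is of symmetric Lie type if such $D$ can be taken symmetric with respect to the inner product on $\mathfrak N/\mathfrak Z$. **Action and moment map.** $GL_q\mathbb R$ acts on $\mathfrak{so}(q)^p$ by $a\cdot C=(aC^1a^t,\dots,aC^pa^t)$; the induced action of $X\in\mathfrak{gl}_q\mathbb R$ is $X\cdot C=(XC^1+C^1X^t,\dots,XC^p+C^pX^t)$. The moment map of this action is $m_1(C)=-2\sum_\alpha (C^\alpha)^2$. *)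

theory Defs
  imports "HOL-Analysis.Analysis" "HOL-Algebra.Generated_Groups"
begin

text \<open>
  A tuple \<open>C = (C\<^sup>1, \<dots>, C\<^sup>p)\<close> of real \<open>q \<times> q\<close> matrices is an element \<open>C :: real^'q^'q^'p\<close>; the
  matrix \<open>C\<^sup>\<alpha>\<close> is \<open>C $ \<alpha>\<close>. Since index types are nonempty, \<open>p, q \<ge> 1\<close> is automatic.
\<close>

section \<open>The Lie algebra and the simply connected Lie group\<close>

type_synonym ('q, 'p) nil = "(real^'q) \<times> (real^'p)"

text \<open>The bracket of \<open>\<real>\<^sup>q \<oplus> \<real>\<^sup>p\<close>, the bilinear extension of its values on basis vectors (see
  \<open>bracket_basis\<close> below). The inner product of the product type is the one for which
  the standard basis is orthonormal.\<close>

definition bracket :: "real^'q^'q^'p \<Rightarrow> ('q, 'p) nil \<Rightarrow> ('q, 'p) nil \<Rightarrow> ('q, 'p) nil"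
  where "bracket C X Y = (0, \<chi> k. \<Sum>i\<in>UNIV. \<Sum>j\<in>UNIV. C$k$i$j * fst X $ i * fst Y $ j)"

text \<open>The group in exponential coordinates: by the Baker--Campbell--Hausdorff formula, which stops
  after the first bracket for a 2-step nilpotent Lie algebra. The tangent space at the identity \<open>0\<close>
  is the Lie algebra, and \<open>exp\<close> is the identity map.\<close>

definition nil_mult :: "real^'q^'q^'p \<Rightarrow> ('q, 'p) nil \<Rightarrow> ('q, 'p) nil \<Rightarrow> ('q, 'p) nil"
  where "nil_mult C x y = x + y + (1/2) *\<^sub>R bracket C x y"

definition nil_group :: "real^'q^'q^'p \<Rightarrow> ('q, 'p) nil monoid"
  where "nil_group C = \<lparr>carrier = UNIV, mult = nil_mult C, one = 0\<rparr>"

definition left_field :: "real^'q^'q^'p \<Rightarrow> ('q, 'p) nil \<Rightarrow> ('q, 'p) nil \<Rightarrow> ('q, 'p) nil"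
  where "left_field C v x = frechet_derivative (nil_mult C x) (at 0) v"

text \<open>Left translation of tangent vectors at \<open>x\<close> to the identity (the inverse of \<open>x\<close> is \<open>- x\<close>).\<close>

definition to_identity :: "real^'q^'q^'p \<Rightarrow> ('q, 'p) nil \<Rightarrow> ('q, 'p) nil \<Rightarrow> ('q, 'p) nil"
  where "to_identity C x u = frechet_derivative (nil_mult C (- x)) (at x) u"

definition nil_metric :: "real^'q^'q^'p \<Rightarrow> ('q, 'p) nil \<Rightarrow> ('q, 'p) nil \<Rightarrow> ('q, 'p) nil \<Rightarrow> real"
  where "nil_metric C x u v = to_identity C x u \<bullet> to_identity C x v"


section \<open>The principal bundle, its connection and its curvature\<close>

definition commutator_group :: "real^'q^'q^'p \<Rightarrow> ('q, 'p) nil set"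
  where "commutator_group C = derived (nil_group C) (carrier (nil_group C))"

definition commutator_algebra :: "real^'q^'q^'p \<Rightarrow> ('q, 'p) nil set"
  where "commutator_algebra C = {v. \<forall>t::real. t *\<^sub>R v \<in> commutator_group C}"

definition horizontal :: "real^'q^'q^'p \<Rightarrow> ('q, 'p) nil set"
  where "horizontal C = {v. \<forall>z\<in>commutator_algebra C. v \<bullet> z = 0}"

text \<open>For linearly independent skew-symmetric \<open>C\<close> the commutator group is \<open>0 \<times> \<real>\<^sup>p\<close>, so the abelian
  quotient Lie group \<open>M = N / Z\<close> is \<open>\<real>\<^sup>q\<close> with projection \<open>fst\<close> (see \<open>commutator_group_eq\<close>,
  \<open>nil_group_quotient\<close>). The structure algebra \<open>\<gg>\<close> is \<open>\<real>\<^sup>p\<close>, identified with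
  the Lie algebra of \<open>Z\<close> by \<open>z \<mapsto> (0, z)\<close>.\<close>

definition base_group :: "(real^'q) monoid"
  where "base_group = \<lparr>carrier = UNIV, mult = (+), one = 0\<rparr>"

definition proj :: "('q::finite, 'p::finite) nil \<Rightarrow> real^'q"
  where "proj = fst"

definition dproj :: "('q::finite, 'p::finite) nil \<Rightarrow> ('q, 'p) nil \<Rightarrow> real^'q"
  where "dproj x u = frechet_derivative proj (at x) u"

definition vertical :: "real^'p \<Rightarrow> ('q::finite, 'p::finite) nil"
  where "vertical z = (0, z)"

definition conn :: "real^'q^'q^'p \<Rightarrow> ('q, 'p) nil \<Rightarrow> ('q, 'p) nil \<Rightarrow> real^'p"
  where "conn C x u = snd (to_identity C x u)"

text \<open>Exterior derivative of a vector-valued 1-form on a vector space,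
  \<open>d\<omega>(X, Y) = X \<omega>(Y) - Y \<omega>(X) - \<omega>([X, Y])\<close>, evaluated on constant fields.\<close>

definition ext_deriv :: "('a::real_normed_vector \<Rightarrow> 'a \<Rightarrow> 'b::real_normed_vector) \<Rightarrow> 'a \<Rightarrow> 'a \<Rightarrow> 'a \<Rightarrow> 'b"
  where "ext_deriv \<omega> x u v =
    frechet_derivative (\<lambda>y. \<omega> y v) (at x) u - frechet_derivative (\<lambda>y. \<omega> y u) (at x) v"

definition curv :: "real^'q^'q^'p \<Rightarrow> ('q, 'p) nil \<Rightarrow> ('q, 'p) nil \<Rightarrow> ('q, 'p) nil \<Rightarrow> real^'p"
  where "curv C = ext_deriv (conn C)"

text \<open>The 2-form on \<open>M\<close> whose pullback is the curvature, and the metric on \<open>M\<close> for which the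
  projection is a Riemannian submersion. Existence and uniqueness are proved in
  \<open>base_curv_descends\<close>, \<open>base_curv_unique\<close>, \<open>base_metric_submersion\<close>, \<open>base_metric_unique\<close>.\<close>

definition base_curv :: "real^'q^'q^'p \<Rightarrow> real^'q \<Rightarrow> real^'q \<Rightarrow> real^'q \<Rightarrow> real^'p"
  where "base_curv C = (THE F. \<forall>x u v. curv C x u v = F (proj x) (dproj x u) (dproj x v))"

definition base_metric :: "real^'q^'q^'p \<Rightarrow> real^'q \<Rightarrow> real^'q \<Rightarrow> real^'q \<Rightarrow> real"
  where "base_metric C = (THE h. \<forall>x u v. conn C x u = 0 \<and> conn C x v = 0 \<longrightarrow>
    h (proj x) (dproj x u) (dproj x v) = nil_metric C x u v)"

definition base_field :: "real^'q \<Rightarrow> real^'q \<Rightarrow> real^'q"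
  where "base_field v m = frechet_derivative (\<lambda>y. m + y) (at 0) v"

definition fibre_metric :: "real^'q^'q^'p \<Rightarrow> real^'p \<Rightarrow> real^'p \<Rightarrow> real"
  where "fibre_metric C a b = nil_metric C 0 (vertical a) (vertical b)"

definition base_metric_matrix :: "real^'q^'q^'p \<Rightarrow> real^'q \<Rightarrow> real^'q^'q"
  where "base_metric_matrix C m = (\<chi> i j. base_metric C m (axis i 1) (axis j 1))"

definition fibre_metric_matrix :: "real^'q^'q^'p \<Rightarrow> real^'p^'p"
  where "fibre_metric_matrix C = (\<chi> \<alpha> \<beta>. fibre_metric C (axis \<alpha> 1) (axis \<beta> 1))"

definition curv_component :: "real^'q^'q^'p \<Rightarrow> real^'q \<Rightarrow> 'p \<Rightarrow> 'q \<Rightarrow> 'q \<Rightarrow> real"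
  where "curv_component C m \<alpha> i j =
    fibre_metric C (axis \<alpha> 1) (base_curv C m (axis i 1) (axis j 1))"

definition curv_sq_component :: "real^'q^'q^'p \<Rightarrow> real^'q \<Rightarrow> 'q \<Rightarrow> 'q \<Rightarrow> real"
  where "curv_sq_component C m i j =
    (\<Sum>k\<in>UNIV. \<Sum>l\<in>UNIV. \<Sum>\<alpha>\<in>UNIV. \<Sum>\<beta>\<in>UNIV.
      matrix_inv (base_metric_matrix C m) $ k $ l * matrix_inv (fibre_metric_matrix C) $ \<alpha> $ \<beta> *
      curv_component C m \<alpha> k i * curv_component C m \<beta> l j)"

definition curv_sq :: "real^'q^'q^'p \<Rightarrow> real^'q \<Rightarrow> real^'q \<Rightarrow> real^'q \<Rightarrow> real"
  where "curv_sq C m v w = (\<Sum>i\<in>UNIV. \<Sum>j\<in>UNIV. curv_sq_component C m i j * v $ i * w $ j)"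


section \<open>Ricci Yang--Mills solitons of Lie type\<close>

text \<open>The quotient Lie algebra is the tangent space \<open>\<real>\<^sup>q\<close> of \<open>M\<close> at \<open>0\<close>; being abelian, its
  derivations are all linear maps.\<close>

definition base_adjoint :: "real^'q^'q^'p \<Rightarrow> (real^'q \<Rightarrow> real^'q) \<Rightarrow> (real^'q \<Rightarrow> real^'q) \<Rightarrow> bool"
  where "base_adjoint C D D' \<longleftrightarrow>
    linear D' \<and> (\<forall>v w. base_metric C 0 (D' v) w = base_metric C 0 v (D w))"

definition RYM_soliton_data :: "real^'q^'q^'p \<Rightarrow> real \<Rightarrow> (real^'q \<Rightarrow> real^'q) \<Rightarrow> bool"
  where "RYM_soliton_data C lam D \<longleftrightarrow> linear D \<and>
    (\<exists>D'. base_adjoint C D D' \<and>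
      (\<forall>v w m.
        curv_sq C m (base_field v m) (base_field w m) =
          base_metric C m (base_field (D v + D' v) m) (base_field w m)
          + lam * base_metric C m (base_field v m) (base_field w m) \<and>
        0 = base_curv C m (base_field (D v) m) (base_field w m)
          + base_curv C m (base_field v m) (base_field (D w) m)))"

definition RYM_soliton_Lie_type :: "real^'q^'q^'p \<Rightarrow> bool"
  where "RYM_soliton_Lie_type C \<longleftrightarrow> (\<exists>lam D. RYM_soliton_data C lam D)"

definition RYM_soliton_symmetric_Lie_type :: "real^'q^'q^'p \<Rightarrow> bool"
  where "RYM_soliton_symmetric_Lie_type C \<longleftrightarrow>
    (\<exists>lam D. RYM_soliton_data C lam D \<and>
      (\<forall>v w. base_metric C 0 (D v) w = base_metric C 0 v (D w)))"


section \<open>The action of the general linear group\<close>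

definition gl_act :: "real^'q^'q \<Rightarrow> real^'q^'q^'p \<Rightarrow> real^'q^'q^'p"
  where "gl_act a C = (\<chi> \<alpha>. a ** C$\<alpha> ** transpose a)"

definition inf_act :: "real^'q^'q \<Rightarrow> real^'q^'q^'p \<Rightarrow> real^'q^'q^'p"
  where "inf_act X C = (\<chi> \<alpha>. X ** C$\<alpha> + C$\<alpha> ** transpose X)"

definition moment_map :: "real^'q^'q^'p \<Rightarrow> real^'q^'q"
  where "moment_map C = - (2 *\<^sub>R (\<Sum>\<alpha>\<in>UNIV. C$\<alpha> ** C$\<alpha>))"

definition distinguished_point :: "real^'q^'q^'p \<Rightarrow> bool"
  where "distinguished_point C \<longleftrightarrow> (\<exists>r::real. inf_act (moment_map C) C = r *\<^sub>R C)"


section \<open>Consistency of the definitions\<close>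

lemma bracket_basis:
  "bracket C (axis i 1, 0) (axis j 1, 0) = (0, \<chi> k. C$k$i$j)"
proof -
  have "(\<Sum>a\<in>UNIV. \<Sum>b\<in>UNIV. C$k$a$b * axis i 1 $ a * axis j 1 $ b) = C$k$i$j" for k
    by (simp add: axis_def if_distrib[of "\<lambda>x. _ * x"] cong: if_cong)
  then show ?thesis by (simp add: bracket_def)
qed

lemma bracket_inner: "bracket C X Y = (0, \<chi> k. fst X \<bullet> (C$k *v fst Y))"
  by (simp add: bracket_def inner_vec_def matrix_vector_mult_def sum_distrib_left mult_ac)

lemma bracket_vertical [simp]:
  "bracket C (0, z) Y = 0" "bracket C X (0, z) = 0" "fst (bracket C X Y) = 0"
  by (auto simp: bracket_def zero_prod_def vec_eq_iff)

lemma bracket_bracket [simp]: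
  "bracket C (bracket C X Y) W = 0" "bracket C W (bracket C X Y) = 0"
  by (auto simp: bracket_def zero_prod_def vec_eq_iff)

lemma bracket_bilinear: "bilinear (bracket C)"
  unfolding bilinear_def
  by (auto intro!: linearI simp: bracket_inner vec_eq_iff inner_add_left inner_add_right
      matrix_vector_right_distrib matrix_vector_mult_scaleR)

lemmas bracket_linear_simps =
  bilinear_ladd[OF bracket_bilinear] bilinear_radd[OF bracket_bilinear]
  bilinear_lmul[OF bracket_bilinear] bilinear_rmul[OF bracket_bilinear]
  bilinear_lneg[OF bracket_bilinear] bilinear_rneg[OF bracket_bilinear]
  bilinear_lzero[OF bracket_bilinear] bilinear_rzero[OF bracket_bilinear]

lemma bracket_has_derivative:
  "(bracket C x has_derivative bracket C x) F"
  "((\<lambda>y. bracket C y x) has_derivative (\<lambda>y. bracket C y x)) F"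
proof -
  have "linear (bracket C x)" "linear (\<lambda>y. bracket C y x)"
    using bracket_bilinear[of C] unfolding bilinear_def by blast+
  then show "(bracket C x has_derivative bracket C x) F"
    "((\<lambda>y. bracket C y x) has_derivative (\<lambda>y. bracket C y x)) F"
    by (auto intro: bounded_linear_imp_has_derivative simp: linear_conv_bounded_linear)
qed

lemma minus_mv: "(- A) *v x = - (A *v x)" for A :: "real^'n^'m"
  by (simp add: vec_eq_iff matrix_vector_mult_def sum_negf)

lemma bracket_skew:
  assumes "\<And>\<alpha>. transpose (C$\<alpha>) = - (C$\<alpha>)"
  shows "bracket C X Y = - bracket C Y X"
proof -
  have "fst X \<bullet> (C$k *v fst Y) = - (fst Y \<bullet> (C$k *v fst X))" for k
  proof -
    have "fst X \<bullet> (C$k *v fst Y) = (transpose (C$k) *v fst X) \<bullet> fst Y"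
      by (simp add: dot_lmul_matrix)
    also have "\<dots> = - (fst Y \<bullet> (C$k *v fst X))"
      by (simp add: assms inner_commute minus_mv)
    finally show ?thesis .
  qed
  then show ?thesis by (simp add: bracket_inner vec_eq_iff)
qed

lemma bracket_self:
  assumes "\<And>\<alpha>. transpose (C$\<alpha>) = - (C$\<alpha>)"
  shows "bracket C X X = 0"
  using bracket_skew[OF assms, of X X] by (simp add: bracket_def vec_eq_iff zero_prod_def)

lemma nil_group_group:
  assumes "\<And>\<alpha>. transpose (C$\<alpha>) = - (C$\<alpha>)"
  shows "group (nil_group C)"
proof (rule groupI)
  fix x assume "x \<in> carrier (nil_group C)"
  show "\<exists>y\<in>carrier (nil_group C). y \<otimes>\<^bsub>nil_group C\<^esub> x = \<one>\<^bsub>nil_group C\<^esub>"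
    by (rule bexI[of _ "- x"])
      (auto simp: nil_group_def nil_mult_def bracket_linear_simps bracket_self[OF assms])
qed (auto simp: nil_group_def nil_mult_def bracket_linear_simps algebra_simps)

lemma nil_group_inv:
  assumes "\<And>\<alpha>. transpose (C$\<alpha>) = - (C$\<alpha>)"
  shows "inv\<^bsub>nil_group C\<^esub> x = - x"
  by (rule group.inv_equality[OF nil_group_group[OF assms]])
    (auto simp: nil_group_def nil_mult_def bracket_linear_simps bracket_self[OF assms])

lemma simply_connected_nil_group: "simply_connected (carrier (nil_group C))"
  by (simp add: nil_group_def convex_imp_simply_connected)

lemma nil_mult_has_derivative:
  "(nil_mult C x has_derivative (\<lambda>u. u + (1/2) *\<^sub>R bracket C x u)) F"
  unfolding nil_mult_def
  by (auto intro!: derivative_eq_intros bracket_has_derivative)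

lemma left_field_eq: "left_field C v x = v + (1/2) *\<^sub>R bracket C x v"
  unfolding left_field_def
  by (simp add: frechet_derivative_at[OF nil_mult_has_derivative, symmetric])

lemma to_identity_eq: "to_identity C x u = u - (1/2) *\<^sub>R bracket C x u"
  unfolding to_identity_def
  by (simp add: frechet_derivative_at[OF nil_mult_has_derivative, symmetric] bracket_linear_simps)

lemma to_identity_left_field: "to_identity C x (left_field C v x) = v"
  by (simp add: to_identity_eq left_field_eq bracket_linear_simps)

text \<open>The commutator of left-invariant vector fields is the left-invariant field of the bracket, so
  the Lie algebra of the group is the given one.\<close>

lemma left_field_bracket:
  assumes "\<And>\<alpha>. transpose (C$\<alpha>) = - (C$\<alpha>)"
  shows "frechet_derivative (left_field C w) (at x) (left_field C v x)
    - frechet_derivative (left_field C v) (at x) (left_field C w x) = left_field C (bracket C v w) x"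
proof -
  have der: "(left_field C v has_derivative (\<lambda>u. (1/2) *\<^sub>R bracket C u v)) (at x)" for v x
    unfolding left_field_eq[abs_def]
    by (auto intro!: derivative_eq_intros bracket_has_derivative)
  show ?thesis
    by (simp add: frechet_derivative_at[OF der, symmetric] left_field_eq bracket_linear_simps
        bracket_skew[OF assms, of w v] flip: scaleR_add_left)
qed

text \<open>The commutator subgroup and the quotient\<close>

lemma tuple_orthogonal:
  assumes "inj (($) C)" "independent (range (($) C))"
    and "\<And>X Y. c \<bullet> snd (bracket C X Y) = 0"
  shows "c = 0"
proof -
  have "(\<Sum>k\<in>UNIV. c$k *\<^sub>R C$k) = 0"
    unfolding vec_eq_iff
  proof (intro allI)
    fix i j
    have "c \<bullet> snd (bracket C (axis i 1, 0) (axis j 1, 0)) = 0" by (rule assms(3))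
    then show "(\<Sum>k\<in>UNIV. c$k *\<^sub>R C$k) $ i $ j = 0 $ i $ j"
      by (simp add: bracket_basis inner_vec_def)
  qed
  moreover have "(\<Sum>k\<in>UNIV. c$k *\<^sub>R C$k) = (\<Sum>B\<in>range (($) C). c $ (inv_into UNIV (($) C) B) *\<^sub>R B)"
    using assms(1) by (simp add: sum.reindex)
  ultimately have "\<And>B. B \<in> range (($) C) \<Longrightarrow> c $ (inv_into UNIV (($) C) B) = 0"
    using independentD[OF assms(2), of "range (($) C)" "\<lambda>B. c $ (inv_into UNIV (($) C) B)"]
    by simp
  from this[OF rangeI] show ?thesis using assms(1) by (simp add: vec_eq_iff)
qed

lemma commutator_group_eq:
  fixes C :: "real^'q^'q^'p"
  assumes skew: "\<And>\<alpha>. transpose (C$\<alpha>) = - (C$\<alpha>)"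
    and indep: "inj (($) C)" "independent (range (($) C))"
  shows "commutator_group C = {0} \<times> UNIV"
proof -
  interpret group "nil_group C" by (rule nil_group_group[OF skew])
  define B where "B = (\<Union>X\<in>UNIV. \<Union>Y\<in>UNIV. {bracket C X Y})"
  have inB: "bracket C X Y \<in> B" for X Y
    unfolding B_def by blast
  have exB: "\<exists>X Y. h = bracket C X Y" if "h \<in> B" for h
    using that unfolding B_def by blast
  have comm: "nil_mult C (nil_mult C (nil_mult C x y) (- x)) (- y) = bracket C x y" for x y
    using bracket_skew[OF skew, of y x]
    by (simp add: nil_mult_def bracket_linear_simps bracket_self[OF skew]
        algebra_simps flip: scaleR_add_left)
  have ds: "derived_set (nil_group C) (carrier (nil_group C)) = B"
  proof -
    have car: "carrier (nil_group C) = UNIV" by (simp add: nil_group_def)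
    have "x \<otimes>\<^bsub>nil_group C\<^esub> y \<otimes>\<^bsub>nil_group C\<^esub> inv\<^bsub>nil_group C\<^esub> x
        \<otimes>\<^bsub>nil_group C\<^esub> inv\<^bsub>nil_group C\<^esub> y = bracket C x y" for x y
      unfolding nil_group_inv[OF skew] by (simp add: nil_group_def comm)
    then show ?thesis unfolding car B_def by simp
  qed
  have gen: "commutator_group C = generate (nil_group C) B"
    by (simp only: commutator_group_def derived_def ds)
  have fst0: "x \<in> generate (nil_group C) B \<Longrightarrow> fst x = 0" for x
  proof (induction rule: generate.induct)
    case (incl h)
    then obtain X Y where "h = bracket C X Y" using exB by blast
    then show ?case by simp
  next
    case (inv h)
    then obtain X Y where "h = bracket C X Y" using exB by blast
    then show ?case by (simp add: nil_group_inv[OF skew])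
  qed (auto simp: nil_group_def nil_mult_def)
  let ?S = "snd ` generate (nil_group C) B"
  have scale: "x \<in> generate (nil_group C) B \<Longrightarrow> c *\<^sub>R x \<in> generate (nil_group C) B" for x c
  proof (induction rule: generate.induct)
    case one
    then show ?case using generate.one[of "nil_group C" B] by (simp add: nil_group_def)
  next
    case (incl h)
    then obtain X Y where "h = bracket C X Y" using exB by blast
    then have "c *\<^sub>R h = bracket C (c *\<^sub>R X) Y" by (simp add: bracket_linear_simps)
    then show ?case by (simp add: generate.incl inB)
  next
    case (inv h)
    then obtain X Y where "h = bracket C X Y" using exB by blast
    then have "c *\<^sub>R (- h) = bracket C ((- c) *\<^sub>R X) Y" by (simp add: bracket_linear_simps)
    then show ?case by (simp add: generate.incl inB nil_group_inv[OF skew])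
  next
    case (eng h1 h2)
    have "bracket C h1 h2 = 0"
      using fst0[OF eng.hyps(1)] by (simp add: bracket_def vec_eq_iff zero_prod_def)
    moreover have "bracket C (c *\<^sub>R h1) (c *\<^sub>R h2) = 0"
      using fst0[OF eng.hyps(1)] by (simp add: bracket_def vec_eq_iff zero_prod_def)
    ultimately have "c *\<^sub>R (h1 \<otimes>\<^bsub>nil_group C\<^esub> h2) = (c *\<^sub>R h1) \<otimes>\<^bsub>nil_group C\<^esub> (c *\<^sub>R h2)"
      by (simp add: nil_group_def nil_mult_def algebra_simps)
    then show ?case using generate.eng[OF eng.IH] by simp
  qed
  have add: "x + y \<in> generate (nil_group C) B"
    if "x \<in> generate (nil_group C) B" "y \<in> generate (nil_group C) B" for x y
  proof -
    have "x \<otimes>\<^bsub>nil_group C\<^esub> y = x + y"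
      using fst0[OF that(1)] by (simp add: nil_group_def nil_mult_def bracket_def zero_prod_def vec_eq_iff)
    then show ?thesis using generate.eng[OF that] by simp
  qed
  have sub: "subspace (generate (nil_group C) B)"
    using generate.one[of "nil_group C" B] add scale
    by (auto simp: subspace_def nil_group_def)
  then have subS: "subspace ?S"
    by (rule linear_subspace_image[OF linear_snd])
  have "?S = UNIV"
  proof (rule ccontr)
    assume "?S \<noteq> UNIV"
    then have "span ?S \<noteq> UNIV" using span_eq_iff subS by metis
    then obtain a where a: "a \<noteq> 0" "\<forall>x\<in>span ?S. a \<bullet> x = 0"
      using span_not_UNIV_orthogonal by blast
    have "a \<bullet> snd (bracket C X Y) = 0" for X Y
    proof -
      have "bracket C X Y \<in> generate (nil_group C) B" by (simp add: generate.incl inB)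
      then show ?thesis using a(2) by (auto intro: span_base)
    qed
    then show False using tuple_orthogonal[OF indep] a(1) by blast
  qed
  show ?thesis
  proof (intro equalityI subsetI)
    fix x assume "x \<in> commutator_group C"
    then show "x \<in> {0::real^'q} \<times> (UNIV :: (real^'p) set)"
      using fst0[of x] gen by (simp add: mem_Times_iff)
  next
    fix x assume "x \<in> {0::real^'q} \<times> (UNIV :: (real^'p) set)"
    then have x: "fst x = 0" by auto
    obtain y where "y \<in> generate (nil_group C) B" "snd y = snd x"
      using \<open>?S = UNIV\<close> by (metis UNIV_I imageE)
    then show "x \<in> commutator_group C" using fst0[of y] x gen by (metis prod_eqI)
  qed
qed

lemma commutator_algebra_eq:
  assumes "\<And>\<alpha>. transpose (C$\<alpha>) = - (C$\<alpha>)" "inj (($) C)" "independent (range (($) C))"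
  shows "commutator_algebra C = range vertical" "horizontal C = UNIV \<times> {0}"
proof -
  show 1: "commutator_algebra C = range vertical"
    unfolding commutator_algebra_def commutator_group_eq[OF assms] vertical_def
    by (auto dest: spec[of _ 1])
  show "horizontal C = UNIV \<times> {0}"
    unfolding horizontal_def 1 vertical_def
    by (auto simp: inner_prod_def)
qed

lemma nil_group_quotient:
  assumes "\<And>\<alpha>. transpose (C$\<alpha>) = - (C$\<alpha>)" "inj (($) C)" "independent (range (($) C))"
  shows "proj \<in> hom (nil_group C) base_group"
    and "proj ` carrier (nil_group C) = carrier base_group"
    and "kernel (nil_group C) base_group proj = commutator_group C"
  by (auto simp: hom_def nil_group_def base_group_def proj_def nil_mult_def
      kernel_def commutator_group_eq[OF assms] image_iff)

text \<open>The connection form is left-invariant, vanishes on the horizontal space and is the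
  identification on the vertical one.\<close>

lemma conn_eq: "conn C x u = snd u - (1/2) *\<^sub>R snd (bracket C x u)"
  by (simp add: conn_def to_identity_eq)

lemma conn_left_invariant: "conn C x (left_field C v x) = conn C 0 v"
  by (simp add: conn_def to_identity_left_field) (simp add: to_identity_eq bracket_linear_simps)

lemma conn_horizontal:
  assumes "\<And>\<alpha>. transpose (C$\<alpha>) = - (C$\<alpha>)" "inj (($) C)" "independent (range (($) C))"
    and "v \<in> horizontal C"
  shows "conn C 0 v = 0"
  using assms(4) by (auto simp: commutator_algebra_eq[OF assms(1-3)] conn_eq bracket_linear_simps)

lemma conn_vertical: "conn C 0 (vertical z) = z"
  by (simp add: conn_eq vertical_def)

lemma dproj_eq: "dproj x u = fst u"
  unfolding dproj_def proj_def
  by (simp add: frechet_derivative_at[OF bounded_linear_imp_has_derivative[OF bounded_linear_fst], symmetric])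

lemma curv_eq:
  assumes "\<And>\<alpha>. transpose (C$\<alpha>) = - (C$\<alpha>)"
  shows "curv C x u v = - snd (bracket C u v)"
proof -
  have der: "((\<lambda>y. conn C y v) has_derivative (\<lambda>u. - (1/2) *\<^sub>R snd (bracket C u v))) (at x)" for v
    unfolding conn_eq
    by (auto intro!: derivative_eq_intros has_derivative_snd bracket_has_derivative)
  show ?thesis
    by (simp add: curv_def ext_deriv_def frechet_derivative_at[OF der, symmetric]
        bracket_skew[OF assms, of v u] flip: scaleR_add_left)
qed

lemma base_curv_unique:
  assumes "\<forall>x u v. curv C x u v = F (proj x) (dproj x u) (dproj x v)"
    and "\<forall>x u v. curv C x u v = F' (proj x) (dproj x u) (dproj x v)"
  shows "F = F'"
proof (intro ext)
  fix m a b
  show "F m a b = F' m a b"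
    using assms[THEN spec, of "(m, 0)"] unfolding dproj_eq proj_def by (metis fst_conv)
qed

lemma base_curv_eq:
  assumes "\<And>\<alpha>. transpose (C$\<alpha>) = - (C$\<alpha>)"
  shows "base_curv C m a b = - (\<chi> k. a \<bullet> (C$k *v b))"
proof -
  have "base_curv C = (\<lambda>m a b. - (\<chi> k. a \<bullet> (C$k *v b)))"
    unfolding base_curv_def
    by (rule the_equality, simp add: curv_eq[OF assms] bracket_inner dproj_eq)
      (rule base_curv_unique, assumption, simp add: curv_eq[OF assms] bracket_inner dproj_eq)
  then show ?thesis by simp
qed

lemma base_curv_descends:
  assumes "\<And>\<alpha>. transpose (C$\<alpha>) = - (C$\<alpha>)"
  shows "curv C x u v = base_curv C (proj x) (dproj x u) (dproj x v)"
  by (simp add: curv_eq[OF assms] base_curv_eq[OF assms] bracket_inner dproj_eq)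

lemma base_metric_unique:
  assumes "\<forall>x u v. conn C x u = 0 \<and> conn C x v = 0 \<longrightarrow> h (proj x) (dproj x u) (dproj x v) = nil_metric C x u v"
    and "\<forall>x u v. conn C x u = 0 \<and> conn C x v = 0 \<longrightarrow> h' (proj x) (dproj x u) (dproj x v) = nil_metric C x u v"
  shows "h = h'"
proof (intro ext)
  fix m a b
  have "conn C (m, 0) (left_field C (a, 0) (m, 0)) = 0" for a
    by (simp add: conn_def to_identity_left_field)
  moreover have "fst (left_field C (a, 0) (m, 0)) = a" for a
    by (simp add: left_field_eq)
  ultimately show "h m a b = h' m a b"
    using assms[THEN spec, of "(m, 0)"] unfolding dproj_eq proj_def by (metis fst_conv)
qed

lemma nil_metric_horizontal:
  assumes "conn C x u = 0" "conn C x v = 0"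
  shows "nil_metric C x u v = fst u \<bullet> fst v"
  using assms by (simp add: nil_metric_def inner_prod_def conn_def) (simp add: to_identity_eq)

lemma base_metric_eq: "base_metric C m a b = a \<bullet> b"
proof -
  have "base_metric C = (\<lambda>m a b. a \<bullet> b)"
    unfolding base_metric_def
    by (rule the_equality, simp add: nil_metric_horizontal dproj_eq)
      (rule base_metric_unique, assumption, simp add: nil_metric_horizontal dproj_eq)
  then show ?thesis by simp
qed

lemma base_metric_submersion:
  assumes "conn C x u = 0" "conn C x v = 0"
  shows "base_metric C (proj x) (dproj x u) (dproj x v) = nil_metric C x u v"
  using assms by (simp add: base_metric_eq nil_metric_horizontal dproj_eq)

lemma base_field_eq: "base_field v m = v"
proof -
  have "((\<lambda>y. m + y) has_derivative (\<lambda>u. u)) (at 0)"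
    by (auto intro!: derivative_eq_intros)
  from frechet_derivative_at[OF this] show ?thesis unfolding base_field_def by metis
qed

lemma fibre_metric_eq: "fibre_metric C a b = a \<bullet> b"
  by (simp add: fibre_metric_def nil_metric_def to_identity_eq vertical_def inner_prod_def)

text \<open>The infinitesimal action is the derivative of the group action at the identity, and the moment
  map represents \<open>X \<mapsto> \<langle>X \<cdot> C, C\<rangle>\<close>, half the derivative of the squared norm along it.\<close>

lemma inf_act_derivative:
  fixes C :: "real^'q^'q^'p"
  shows "((\<lambda>a. gl_act a C) has_derivative (\<lambda>X. inf_act X C)) (at (mat 1))"
proof -
  interpret bl: bounded_bilinear "\<lambda>(a::real^'q^'q) (b::real^'q^'q). \<chi> \<alpha>. a ** C$\<alpha> ** transpose b"
  proof (intro bilinear_conv_bounded_bilinear[THEN iffD1])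
    show "bilinear (\<lambda>(a::real^'q^'q) (b::real^'q^'q). \<chi> \<alpha>. a ** C$\<alpha> ** transpose b)"
      unfolding bilinear_def
      by (auto intro!: linearI
          simp: vec_eq_iff matrix_matrix_mult_def transpose_def sum.distrib sum_distrib_left
                sum_distrib_right algebra_simps)
  qed
  have "((\<lambda>a. gl_act a C) has_derivative (\<lambda>X. (\<chi> \<alpha>. mat 1 ** C$\<alpha> ** transpose X) +
      (\<chi> \<alpha>. X ** C$\<alpha> ** transpose (mat 1)))) (at (mat 1))"
    unfolding gl_act_def by (rule bl.FDERIV) (auto intro: has_derivative_ident)
  moreover have "(\<lambda>X. (\<chi> \<alpha>. mat 1 ** C$\<alpha> ** transpose X) + (\<chi> \<alpha>. X ** C$\<alpha> ** transpose (mat 1)))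
      = (\<lambda>X. inf_act X C)"
    by (auto simp: inf_act_def vec_eq_iff)
  ultimately show ?thesis by simp
qed

lemma moment_map_inner:
  assumes skew: "\<And>\<alpha>. transpose (C$\<alpha>) = - (C$\<alpha>)"
  shows "moment_map C \<bullet> X = inf_act X C \<bullet> C"
proof -
  have s: "C$\<alpha>$j$i = - C$\<alpha>$i$j" for \<alpha> i j
    using arg_cong[OF skew[of \<alpha>], of "\<lambda>A. A$i$j"] by (simp add: transpose_def)
  have e: "C$\<alpha>$i$k * C$\<alpha>$k$j * X$i$j = - (X$i$j * C$\<alpha>$j$k * C$\<alpha>$i$k)" for \<alpha> i j k
    by (subst s[of \<alpha> j k]) (simp only: mult_minus_left mult_minus_right minus_minus mult_ac)
  have A: "(C$\<alpha> ** C$\<alpha>) \<bullet> X = - ((X ** C$\<alpha>) \<bullet> C$\<alpha>)" for \<alpha>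
  proof -
    have "(C$\<alpha> ** C$\<alpha>) \<bullet> X = (\<Sum>i\<in>UNIV. \<Sum>j\<in>UNIV. \<Sum>k\<in>UNIV. C$\<alpha>$i$k * C$\<alpha>$k$j * X$i$j)"
      by (simp add: inner_vec_def matrix_matrix_mult_def sum_distrib_right)
    also have "\<dots> = (\<Sum>i\<in>UNIV. \<Sum>k\<in>UNIV. \<Sum>j\<in>UNIV. C$\<alpha>$i$k * C$\<alpha>$k$j * X$i$j)"
      by (rule sum.cong[OF refl]) (rule sum.swap)
    also have "\<dots> = (\<Sum>i\<in>UNIV. \<Sum>k\<in>UNIV. \<Sum>j\<in>UNIV. - (X$i$j * C$\<alpha>$j$k * C$\<alpha>$i$k))"
      by (intro sum.cong refl) (rule e)
    also have "\<dots> = - ((X ** C$\<alpha>) \<bullet> C$\<alpha>)"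
      by (simp add: inner_vec_def matrix_matrix_mult_def sum_distrib_right sum_negf)
    finally show ?thesis .
  qed
  have tr: "transpose A \<bullet> transpose B = A \<bullet> B" for A B :: "real^'q^'q"
    unfolding inner_vec_def by (simp add: transpose_def) (rule sum.swap)
  have B: "(C$\<alpha> ** transpose X) \<bullet> C$\<alpha> = (X ** C$\<alpha>) \<bullet> C$\<alpha>" for \<alpha>
  proof -
    have "(C$\<alpha> ** transpose X) \<bullet> C$\<alpha> = transpose (C$\<alpha> ** transpose X) \<bullet> transpose (C$\<alpha>)"
      by (simp add: tr)
    also have "\<dots> = (X ** (- (C$\<alpha>))) \<bullet> (- (C$\<alpha>))"
      by (simp add: matrix_transpose_mul skew)
    also have "X ** (- (C$\<alpha>)) = - (X ** C$\<alpha>)"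
      by (simp add: vec_eq_iff matrix_matrix_mult_def sum_negf)
    finally show ?thesis by simp
  qed
  have "inf_act X C \<bullet> C = (\<Sum>\<alpha>\<in>UNIV. (X ** C$\<alpha> + C$\<alpha> ** transpose X) \<bullet> C$\<alpha>)"
    unfolding inner_vec_def[of "inf_act X C" C] by (simp add: inf_act_def)
  also have "\<dots> = (\<Sum>\<alpha>\<in>UNIV. 2 * ((X ** C$\<alpha>) \<bullet> C$\<alpha>))"
    by (simp add: inner_add_left B)
  also have "\<dots> = moment_map C \<bullet> X"
    by (simp add: moment_map_def inner_sum_left A sum_negf sum_distrib_left)
  finally show ?thesis by simp
qed

end

theory Submission
  imports Defs
begin

text \<open>
  In the standard frames \<open>\<Omega>\<^sub>\<alpha> = - C\<^sup>\<alpha>\<close>, so the squared curvature is \<open>-\<Sum> (C\<^sup>\<alpha>)\<^sup>2 = m\<^sub>1(C)/2\<close>. For a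
  symmetric \<open>D\<close> the soliton equations therefore say \<open>m\<^sub>1(C) = 4 D + 2 \<lambda>\<close> and \<open>D C\<^sup>\<alpha> + C\<^sup>\<alpha> D = 0\<close>.
  The first one determines \<open>D\<close> from \<open>\<lambda>\<close>, and it turns the second one into
  \<open>m\<^sub>1(C) \<cdot> C = 4 \<lambda> C\<close>.
\<close>

lemma matrix_inv_mat_1: "matrix_inv (mat 1 :: 'a::semiring_1^'n^'n) = mat 1"
  using someI[of "\<lambda>B. mat 1 ** B = mat 1 \<and> B ** mat 1 = mat 1" "mat 1 :: 'a^'n^'n"]
  by (simp add: matrix_inv_def)

lemma skew_symmetric_entry:
  fixes A :: "'a::ring^'n^'n"
  assumes "transpose A = - A"
  shows "A $ j $ i = - A $ i $ j"
  using arg_cong[OF assms, of "\<lambda>A. A $ i $ j"] by (simp add: transpose_def)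

text \<open>Transposing a product of two entries of a skew matrix changes the sign twice, so each
  square is symmetric.\<close>

lemma moment_map_symmetric:
  assumes skew: "\<And>\<alpha>. transpose (C $ \<alpha>) = - (C $ \<alpha>)"
  shows "transpose (moment_map C) = moment_map C"
proof -
  have "C$\<alpha>$j$k * C$\<alpha>$k$i = C$\<alpha>$i$k * C$\<alpha>$k$j" for \<alpha> i j k
    by (metis skew_symmetric_entry[OF skew] minus_mult_minus mult.commute)
  then show ?thesis
    by (simp add: moment_map_def vec_eq_iff transpose_def matrix_matrix_mult_def)
qed

text \<open>Both metric matrices are the identity in the standard frames, so the fourfold sum
  collapses to one over \<open>k\<close> and \<open>\<alpha>\<close>, and the signs of the two
  curvature components cancel.\<close>

lemma curv_sq_component_eq:
  assumes skew: "\<And>\<alpha>. transpose (C $ \<alpha>) = - (C $ \<alpha>)"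
  shows "curv_sq_component C m i j = moment_map C $ i $ j / 2"
proof -
  have comp: "curv_component C m \<alpha> a b = - C$\<alpha>$a$b" for \<alpha> a b
    by (simp add: curv_component_def fibre_metric_eq base_curv_eq[OF skew] inner_axis'
        matrix_vector_mult_basis column_def)
  have g: "base_metric_matrix C m = mat 1" "fibre_metric_matrix C = mat 1"
    by (auto simp: base_metric_matrix_def fibre_metric_matrix_def base_metric_eq fibre_metric_eq
        inner_axis_axis mat_def vec_eq_iff)
  have delta: "(\<Sum>b\<in>UNIV. mat 1 $ a $ b * f b) = f a" for a :: "'n::finite" and f :: "'n \<Rightarrow> real"
    by (simp add: mat_def if_distrib[of "\<lambda>x. x * _"] cong: if_cong)
  have "curv_sq_component C m i j = (\<Sum>k\<in>UNIV. \<Sum>\<alpha>\<in>UNIV. C$\<alpha>$k$i * C$\<alpha>$k$j)"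
    by (simp add: curv_sq_component_def g matrix_inv_mat_1 comp delta mult.assoc
        flip: sum_distrib_left)
  \<comment> \<open>Only the factor with column index \<open>i\<close> is transposed; this yields
    the sign and turns the sum into an entry of a matrix square.\<close>
  also have "\<dots> = - (\<Sum>\<alpha>\<in>UNIV. \<Sum>k\<in>UNIV. C$\<alpha>$i$k * C$\<alpha>$k$j)"
    by (subst sum.swap) (simp add: skew_symmetric_entry[OF skew, of _ _ i] sum_negf)
  finally show ?thesis
    by (simp add: moment_map_def matrix_matrix_mult_def)
qed

lemma curv_sq_eq:
  assumes "\<And>\<alpha>. transpose (C $ \<alpha>) = - (C $ \<alpha>)"
  shows "curv_sq C m v w = (moment_map C *v v) \<bullet> w / 2"
proof -
  have "curv_sq C m v w = v \<bullet> (moment_map C *v w) / 2"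
    by (simp add: curv_sq_def curv_sq_component_eq[OF assms] inner_vec_def
        matrix_vector_mult_def sum_distrib_left sum_divide_distrib mult_ac)
  then show ?thesis
    by (metis dot_lmul_matrix moment_map_symmetric[OF assms] vector_transpose_matrix)
qed

text \<open>Nothing depends on the base point \<open>m\<close>, and the inner product is
  nondegenerate, so testing against all vectors turns both soliton equations into vector
  identities.\<close>

lemma RYM_soliton_data_symmetric_iff:
  assumes skew: "\<And>\<alpha>. transpose (C $ \<alpha>) = - (C $ \<alpha>)"
    and sym: "\<And>v w. D v \<bullet> w = v \<bullet> D w"
  shows "RYM_soliton_data C lam D \<longleftrightarrow> linear D \<and>
    (\<forall>v. moment_map C *v v = 4 *\<^sub>R D v + (2 * lam) *\<^sub>R v) \<and>
    (\<forall>\<alpha> v. D (C$\<alpha> *v v) + C$\<alpha> *v D v = 0)"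
proof -
  \<comment> \<open>Adjoints are unique and \<open>D\<close> is its own, so the quantifier over
    \<open>D'\<close> disappears.\<close>
  have adj: "base_adjoint C D D' \<longleftrightarrow> linear D' \<and> D' = D" for D'
    by (auto simp: base_adjoint_def base_metric_eq fun_eq_iff sym[symmetric] vector_eq_rdot)
  have sq: "(\<forall>w. curv_sq C m v w = (D v + D v) \<bullet> w + lam * (v \<bullet> w)) \<longleftrightarrow>
      moment_map C *v v = 4 *\<^sub>R D v + (2 * lam) *\<^sub>R v" for m v
  proof -
    have "curv_sq C m v w = (D v + D v) \<bullet> w + lam * (v \<bullet> w) \<longleftrightarrow>
        (moment_map C *v v) \<bullet> w = (4 *\<^sub>R D v + (2 * lam) *\<^sub>R v) \<bullet> w" for w
      unfolding curv_sq_eq[OF skew] inner_add_left inner_scaleR_left by (simp add: field_simps)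
    then show ?thesis by (simp add: vector_eq_rdot)
  qed
  \<comment> \<open>Symmetry moves \<open>D\<close> off \<open>v\<close> in the first term, leaving
    \<open>v\<close> as a free test vector.\<close>
  have inv: "(\<forall>v. 0 = base_curv C m (D v) w + base_curv C m v (D w)) \<longleftrightarrow>
      (\<forall>\<alpha>. D (C$\<alpha> *v w) + C$\<alpha> *v D w = 0)" for m w
  proof -
    have "(\<forall>v. 0 = base_curv C m (D v) w + base_curv C m v (D w)) \<longleftrightarrow>
        (\<forall>\<alpha> v. v \<bullet> (D (C$\<alpha> *v w) + C$\<alpha> *v D w) = v \<bullet> 0)"
      by (auto simp: base_curv_eq[OF skew] vec_eq_iff sym inner_add_right) (smt (verit))+
    then show ?thesis by (simp only: vector_eq_ldot)
  qed
  show ?thesis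
    unfolding RYM_soliton_data_def adj base_field_eq base_metric_eq
    using sq inv by blast
qed

theorem theorem3p21:
  fixes C :: "real^'q^'q^'p"
  assumes skew: "\<And>\<alpha>. transpose (C $ \<alpha>) = - (C $ \<alpha>)"
    and indep: "inj (($) C)" "independent (range (($) C))"
  shows "RYM_soliton_symmetric_Lie_type C \<longleftrightarrow> distinguished_point C"
proof -
  let ?S = "moment_map C"
  \<comment> \<open>The transpose in the action drops out because \<open>?S\<close> is symmetric.
    Applying matrices to vectors allows comparison with \<open>D\<close>, which is a
    function.\<close>
  have act: "inf_act ?S C = r *\<^sub>R C \<longleftrightarrow>
      (\<forall>\<alpha> v. ?S *v (C$\<alpha> *v v) + C$\<alpha> *v (?S *v v) = r *\<^sub>R (C$\<alpha> *v v))" for r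
  proof -
    have "inf_act ?S C = r *\<^sub>R C \<longleftrightarrow> (\<forall>\<alpha>. ?S ** C$\<alpha> + C$\<alpha> ** ?S = r *\<^sub>R (C$\<alpha>))"
      by (simp add: inf_act_def moment_map_symmetric[OF skew] vec_eq_iff)
    then show ?thesis
      by (simp add: matrix_eq matrix_vector_mult_add_rdistrib
          flip: matrix_vector_mul_assoc scaleR_matrix_vector_assoc)
  qed
  have S_sym: "(?S *v v) \<bullet> w = v \<bullet> (?S *v w)" for v w
    using moment_map_symmetric[OF skew] by (metis dot_lmul_matrix vector_transpose_matrix)
  show ?thesis
  proof
    assume "RYM_soliton_symmetric_Lie_type C"
    then obtain lam D where data: "RYM_soliton_data C lam D"
      and sym: "\<And>v w. D v \<bullet> w = v \<bullet> D w"
      by (auto simp: RYM_soliton_symmetric_Lie_type_def base_metric_eq)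
    have S: "?S *v v = 4 *\<^sub>R D v + (2 * lam) *\<^sub>R v"
      and anti: "D (C$\<alpha> *v v) = - (C$\<alpha> *v D v)" for v \<alpha>
      using data unfolding RYM_soliton_data_symmetric_iff[OF skew sym]
      by (auto simp: eq_neg_iff_add_eq_0)
    \<comment> \<open>The \<open>D\<close> terms cancel by anticommutation; each of the two
      occurrences of \<open>?S\<close> leaves \<open>2 * lam\<close>.\<close>
    have "inf_act ?S C = (4 * lam) *\<^sub>R C"
      unfolding act S anti
      by (simp add: matrix_vector_right_distrib matrix_vector_mult_scaleR flip: scaleR_add_left)
    then show "distinguished_point C"
      unfolding distinguished_point_def ..
  next
    assume "distinguished_point C"
    then obtain r where r: "\<And>\<alpha> v. ?S *v (C$\<alpha> *v v) + C$\<alpha> *v (?S *v v) = r *\<^sub>R (C$\<alpha> *v v)"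
      unfolding distinguished_point_def act by blast
    \<comment> \<open>This solves the first soliton equation for \<open>D\<close> with
      \<open>lam = r/4\<close>. In the anticommutator the two shifts by \<open>r/8\<close> cancel
      the \<open>r/4\<close> coming from \<open>r\<close>.\<close>
    define D where "D v = (1/4) *\<^sub>R (?S *v v) - (r/8) *\<^sub>R v" for v
    have lin: "linear D"
      by (auto intro!: linearI
          simp: D_def matrix_vector_right_distrib matrix_vector_mult_scaleR algebra_simps)
    have sym: "D v \<bullet> w = v \<bullet> D w" for v w
      by (simp add: D_def inner_diff_left inner_diff_right S_sym)
    have "D (C$\<alpha> *v v) + C$\<alpha> *v D v = 0" for \<alpha> v
    proof -
      have "D (C$\<alpha> *v v) + C$\<alpha> *v D v =
          (1/4) *\<^sub>R (?S *v (C$\<alpha> *v v) + C$\<alpha> *v (?S *v v)) - (r/8 + r/8) *\<^sub>R (C$\<alpha> *v v)"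
        unfolding D_def matrix_vector_mult_diff_distrib matrix_vector_mult_scaleR
        by (simp only: scaleR_add_left scaleR_add_right) (simp add: algebra_simps)
      then show ?thesis by (simp add: r)
    qed
    moreover have "?S *v v = 4 *\<^sub>R D v + (2 * (r/4)) *\<^sub>R v" for v
      by (simp add: D_def scaleR_diff_right)
    ultimately have "RYM_soliton_data C (r/4) D"
      using lin by (simp add: RYM_soliton_data_symmetric_iff[OF skew sym])
    then show "RYM_soliton_symmetric_Lie_type C"
      unfolding RYM_soliton_symmetric_Lie_type_def base_metric_eq using sym by blast
  qed
qed

end
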